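(* Let $d_1,d_3,\beta_1,\beta_3,\kappa_1,\kappa_2>0$, $\alpha_1,\alpha_3\ge 0$, $\alpha_2,\alpha_4>0$ and $\mu\in\mathbb{R}$ be constants with $10d_1-\mu+2\alpha_2\neq 0$, satisfying $$\alpha_1=16d_1-4\mu+\beta_1,\quad \alpha_3=\frac{d_3\beta_1}{3d_1},\quad \kappa_1=\frac{5-2\mu}{\alpha_4},\quad \kappa_2=\frac{\beta_1(\alpha_2+\beta_1-24d_1)}{24d_1\alpha_2^2},$$ $$\beta_1=\frac{2\alpha_2^2\left(\alpha_4+(2\mu-5)d_3\right)}{(10d_1-\mu+2\alpha_2)\alpha_4}+24d_1-\alpha_2,\quad \beta_3=\frac{2(2d_3-\mu)\alpha_2+(\beta_1-24d_1)\alpha_4}{\alpha_2}.$$ Then the functions $$u(t,x)=\frac{6d_1}{\beta_1}\big(1-\tanh(x-\mu t)\big)^2,\quad v(t,x)=\frac{24d_1-\beta_1}{2\alpha_2}\big(1-\tanh(x-\mu t)\big),\quad w(t,x)=\frac12+\frac12\tanh(x-\mu t)$$ form an exact solution, for all $(t,x)\in\mathbb{R}^2$, of the system $$u_t = d_1u_{xx}+\beta_1u(1-u)-\alpha_1uw+\alpha_2uv,$$ $$v_t = v_{xx}+ v(1-v)+(\kappa_1\alpha_3+\kappa_2\alpha_1)uw-(\kappa_2\alpha_2u+\kappa_1\alpha_4w)v,$$ $$w_t = d_3 w_{xx}+\beta_3w(1-w)-\alpha_3uw+\alpha_4vw.$$ *)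

theory Defs
  imports "HOL-Analysis.Analysis"
begin

(* Functions of (t, x) are curried, with time as the first argument. *)

definition dt :: "(real \<Rightarrow> real \<Rightarrow> real) \<Rightarrow> real \<Rightarrow> real \<Rightarrow> real" where
  "dt u t x = deriv (\<lambda>s. u s x) t"

definition dx :: "(real \<Rightarrow> real \<Rightarrow> real) \<Rightarrow> real \<Rightarrow> real \<Rightarrow> real" where
  "dx u t x = deriv (\<lambda>y. u t y) x"

abbreviation dxx :: "(real \<Rightarrow> real \<Rightarrow> real) \<Rightarrow> real \<Rightarrow> real \<Rightarrow> real" where
  "dxx u \<equiv> dx (dx u)"

(* Regularity C^{1,2} on the whole plane, as required of a classical solution of a
   second-order evolution equation. The differentiability clauses are essential: deriv
   returns an unspecified value where the derivative does not exist. *)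
definition C12 :: "(real \<Rightarrow> real \<Rightarrow> real) \<Rightarrow> bool" where
  "C12 u \<longleftrightarrow>
     (\<forall>t x. (\<lambda>s. u s x) field_differentiable (at t)) \<and>
     (\<forall>t x. (\<lambda>y. u t y) field_differentiable (at x)) \<and>
     (\<forall>t x. (\<lambda>y. dx u t y) field_differentiable (at x)) \<and>
     continuous_on UNIV (\<lambda>(t, x). u t x) \<and>
     continuous_on UNIV (\<lambda>(t, x). dt u t x) \<and>
     continuous_on UNIV (\<lambda>(t, x). dx u t x) \<and>
     continuous_on UNIV (\<lambda>(t, x). dxx u t x)"

end

(* In the variable y = 1 - tanh (x - \<mu> t) one has u = a y^2, v = b y, w = 1 - y / 2 and
   y' = -y (2 - y), where a = 6 d1 / \<beta>1 and b = (24 d1 - \<beta>1) / (2 \<alpha>2), so each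
   equation becomes a polynomial identity in y. With the implicit equation for \<beta>1 in the form
   (1 - 2 b) (10 d1 - \<mu> + 2 \<alpha>2) = 2 \<alpha>2 (1 - \<kappa>1 d3), all its coefficients vanish. *)
theory Submission
  imports Defs
begin

lemma dt_travelling_wave:
  assumes "\<And>z. (f has_real_derivative f' z) (at z)"
  shows "((\<lambda>s. f (x - c * s)) has_real_derivative - c * f' (x - c * t)) (at t)"
    and "dt (\<lambda>t x. f (x - c * t)) t x = - c * f' (x - c * t)"
proof -
  have "((\<lambda>s. f (x - c * s)) has_real_derivative f' (x - c * t) * (- c)) (at t)"
    by (rule DERIV_chain2[OF assms]) (auto intro!: derivative_eq_intros)
  then show der: "((\<lambda>s. f (x - c * s)) has_real_derivative - c * f' (x - c * t)) (at t)"
    by (simp add: mult.commute)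
  show "dt (\<lambda>t x. f (x - c * t)) t x = - c * f' (x - c * t)"
    unfolding dt_def by (rule DERIV_imp_deriv[OF der])
qed

text \<open>The second claim equates functions, not values at a point, so that rewriting with it
  also reaches the inner \<open>dx\<close> of \<open>dxx\<close>; the second space derivative then
  comes from applying the lemma to \<open>f'\<close>.\<close>

lemma dx_travelling_wave:
  assumes "\<And>z. (f has_real_derivative f' z) (at z)"
  shows "((\<lambda>y. f (y - c * t)) has_real_derivative f' (x - c * t)) (at x)"
    and "dx (\<lambda>t x. f (x - c * t)) = (\<lambda>t x. f' (x - c * t))"
proof -
  show der: "((\<lambda>y. f (y - c * t)) has_real_derivative f' (x - c * t)) (at x)" for t x
    using DERIV_chain2[OF assms, of "\<lambda>y. y - c * t" 1 x UNIV]
    by (simp add: DERIV_diff[of "\<lambda>y. y" 1 x UNIV "\<lambda>_. c * t" 0, simplified])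
  show "dx (\<lambda>t x. f (x - c * t)) = (\<lambda>t x. f' (x - c * t))"
    unfolding dx_def by (intro ext DERIV_imp_deriv der)
qed

text \<open>Every partial derivative involved is again a travelling wave, with profile
  \<open>- c * f'\<close>, \<open>f'\<close> or \<open>f''\<close>, hence continuous once its
  profile is. Only \<open>f''\<close> needs a continuity assumption, since \<open>f\<close> and
  \<open>f'\<close> are differentiable.\<close>

lemma C12_travelling_wave:
  assumes f: "\<And>z. (f has_real_derivative f' z) (at z)"
    and f': "\<And>z. (f' has_real_derivative f'' z) (at z)"
    and f'': "continuous_on UNIV f''"
  shows "C12 (\<lambda>t x. f (x - c * t))"
proof -
  have cont: "continuous_on UNIV (\<lambda>(t, x). g (x - c * t))"
    if "continuous_on UNIV g" for g :: "real \<Rightarrow> real"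
    unfolding split_def
    by (rule continuous_on_compose2[OF that]) (auto intro!: continuous_intros)
  have f_cont: "continuous_on UNIV f" and f'_cont: "continuous_on UNIV f'"
    by (rule DERIV_continuous_on; rule f f')+
  have "continuous_on UNIV (\<lambda>z. - c * f' z)"
    by (intro continuous_intros f'_cont)
  note conts = cont[OF f_cont] cont[OF this] cont[OF f'_cont] cont[OF f'']
  note diffs = dt_travelling_wave(1)[OF f] dx_travelling_wave(1)[OF f] dx_travelling_wave(1)[OF f']
  show ?thesis
    unfolding C12_def dt_travelling_wave(2)[OF f] dx_travelling_wave(2)[OF f]
      dx_travelling_wave(2)[OF f'] field_differentiable_def
    by (intro conjI allI exI conts) (rule diffs)+
qed

theorem mainTheorem2:
  fixes d1 d3 \<alpha>1 \<alpha>2 \<alpha>3 \<alpha>4 \<beta>1 \<beta>3 \<kappa>1 \<kappa>2 \<mu> :: real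
    and u v w :: "real \<Rightarrow> real \<Rightarrow> real"
  assumes "d1 > 0" "d3 > 0" "\<beta>1 > 0" "\<beta>3 > 0" "\<kappa>1 > 0" "\<kappa>2 > 0"
    and "\<alpha>1 \<ge> 0" "\<alpha>3 \<ge> 0" "\<alpha>2 > 0" "\<alpha>4 > 0"
    and "10 * d1 - \<mu> + 2 * \<alpha>2 \<noteq> 0"
    and "\<alpha>1 = 16 * d1 - 4 * \<mu> + \<beta>1"
    and "\<alpha>3 = d3 * \<beta>1 / (3 * d1)"
    and "\<kappa>1 = (5 - 2 * \<mu>) / \<alpha>4"
    and "\<kappa>2 = \<beta>1 * (\<alpha>2 + \<beta>1 - 24 * d1) / (24 * d1 * \<alpha>2\<^sup>2)"
    and "\<beta>1 = 2 * \<alpha>2\<^sup>2 * (\<alpha>4 + (2 * \<mu> - 5) * d3) / ((10 * d1 - \<mu> + 2 * \<alpha>2) * \<alpha>4)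
              + 24 * d1 - \<alpha>2"
    and "\<beta>3 = (2 * (2 * d3 - \<mu>) * \<alpha>2 + (\<beta>1 - 24 * d1) * \<alpha>4) / \<alpha>2"
    and "u = (\<lambda>t x. 6 * d1 / \<beta>1 * (1 - tanh (x - \<mu> * t))\<^sup>2)"
    and "v = (\<lambda>t x. (24 * d1 - \<beta>1) / (2 * \<alpha>2) * (1 - tanh (x - \<mu> * t)))"
    and "w = (\<lambda>t x. 1 / 2 + 1 / 2 * tanh (x - \<mu> * t))"
  shows "C12 u \<and> C12 v \<and> C12 w \<and>
    (\<forall>t x.
       dt u t x = d1 * dxx u t x + \<beta>1 * u t x * (1 - u t x)
                    - \<alpha>1 * u t x * w t x + \<alpha>2 * u t x * v t x \<and>
       dt v t x = dxx v t x + v t x * (1 - v t x)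
                    + (\<kappa>1 * \<alpha>3 + \<kappa>2 * \<alpha>1) * u t x * w t x
                    - (\<kappa>2 * \<alpha>2 * u t x + \<kappa>1 * \<alpha>4 * w t x) * v t x \<and>
       dt w t x = d3 * dxx w t x + \<beta>3 * w t x * (1 - w t x)
                    - \<alpha>3 * u t x * w t x + \<alpha>4 * v t x * w t x)"
proof -
  define a where "a = 6 * d1 / \<beta>1"
  define b where "b = (24 * d1 - \<beta>1) / (2 * \<alpha>2)"
  define Y :: "real \<Rightarrow> real" where "Y = (\<lambda>z. 1 - tanh z)"
  define K where "K = \<kappa>1 * \<alpha>3 + \<kappa>2 * \<alpha>1"

  have u: "u = (\<lambda>t x. a * (Y (x - \<mu> * t))\<^sup>2)"
    and v: "v = (\<lambda>t x. b * Y (x - \<mu> * t))"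
    and w: "w = (\<lambda>t x. 1 - Y (x - \<mu> * t) / 2)"
    using assms(18-20) by (auto simp: a_def b_def Y_def field_simps)

  have Y_cont: "continuous_on UNIV Y"
    unfolding Y_def by (auto intro!: continuous_intros)
  have Y_deriv: "(Y has_real_derivative - (Y z * (2 - Y z))) (at z)" for z
    unfolding Y_def by (auto intro!: derivative_eq_intros simp: power2_eq_square algebra_simps)
  \<comment> \<open>With the Riccati equation for \<open>Y\<close> as a differentiation rule, all
    derivatives below remain polynomials in \<open>Y z\<close>.\<close>
  note [derivative_intros] = DERIV_chain2[OF Y_deriv]

  have u': "((\<lambda>z. a * (Y z)\<^sup>2) has_real_derivative - (2 * a * (Y z)\<^sup>2 * (2 - Y z))) (at z)"
    and u'': "((\<lambda>z. - (2 * a * (Y z)\<^sup>2 * (2 - Y z))) has_real_derivative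
               2 * a * (Y z)\<^sup>2 * (4 - 3 * Y z) * (2 - Y z)) (at z)"
    and v': "((\<lambda>z. b * Y z) has_real_derivative - (b * Y z * (2 - Y z))) (at z)"
    and v'': "((\<lambda>z. - (b * Y z * (2 - Y z))) has_real_derivative
               2 * b * (1 - Y z) * Y z * (2 - Y z)) (at z)"
    and w': "((\<lambda>z. 1 - Y z / 2) has_real_derivative Y z * (2 - Y z) / 2) (at z)"
    and w'': "((\<lambda>z. Y z * (2 - Y z) / 2) has_real_derivative
               - ((1 - Y z) * Y z * (2 - Y z))) (at z)" for z
    by (auto intro!: derivative_eq_intros simp: power2_eq_square field_simps)

  have "C12 u" "C12 v" "C12 w"
    unfolding u v w
    by (rule C12_travelling_wave[OF u' u''] C12_travelling_wave[OF v' v'']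
          C12_travelling_wave[OF w' w'']; intro continuous_intros Y_cont)+

  \<comment> \<open>The constraints are now rewritten in terms of \<open>a\<close> and
    \<open>b\<close>, free of parameter denominators. The one for \<kappa>2 rests on
    \<open>\<alpha>2 + \<beta>1 - 24 * d1 = \<alpha>2 * (1 - 2 * b)\<close>.\<close>
  have \<beta>1a: "\<beta>1 * a = 6 * d1" and \<alpha>3a: "\<alpha>3 * a = 2 * d3"
    using assms(1,3) by (simp_all add: a_def assms(13))
  have \<alpha>2b: "2 * \<alpha>2 * b = 24 * d1 - \<beta>1"
    using assms(9) by (simp add: b_def)
  have \<kappa>1\<alpha>4: "\<kappa>1 * \<alpha>4 = 5 - 2 * \<mu>"
    using assms(10,14) by simp
  have \<beta>3: "\<beta>3 = 4 * d3 - 2 * \<mu> - 2 * \<alpha>4 * b"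
    unfolding assms(17) b_def using assms(9) by (simp add: field_simps)
  have \<kappa>2\<alpha>2a: "\<kappa>2 * \<alpha>2 * a = (1 - 2 * b) / 4"
    unfolding assms(15) a_def b_def using assms(1,3,9)
    by (simp add: field_simps power2_eq_square)
  have \<alpha>1: "\<alpha>1 = 40 * d1 - 4 * \<mu> - 2 * \<alpha>2 * b"
    using assms(12) \<alpha>2b by simp

  have \<beta>1_eq: "(1 - 2 * b) * (10 * d1 - \<mu> + 2 * \<alpha>2) = 2 * \<alpha>2 * (1 - \<kappa>1 * d3)"
  proof -
    define P where "P = 10 * d1 - \<mu> + 2 * \<alpha>2"
    have P: "P \<noteq> 0" using assms(11) by (simp add: P_def)
    have "\<alpha>4 + (2 * \<mu> - 5) * d3 = \<alpha>4 * (1 - \<kappa>1 * d3)"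
      using arg_cong[OF \<kappa>1\<alpha>4, of "\<lambda>z. z * d3"] by (simp add: algebra_simps)
    moreover have "\<alpha>2 * (1 - 2 * b) = \<beta>1 - 24 * d1 + \<alpha>2"
      using \<alpha>2b by (simp add: algebra_simps)
    moreover have "\<beta>1 - 24 * d1 + \<alpha>2 = 2 * \<alpha>2\<^sup>2 * (\<alpha>4 + (2 * \<mu> - 5) * d3) / (P * \<alpha>4)"
      using assms(16) unfolding P_def by linarith
    ultimately have "\<alpha>2 * (1 - 2 * b) = 2 * \<alpha>2\<^sup>2 * (1 - \<kappa>1 * d3) / P"
      using assms(10) by simp
    then have "\<alpha>2 * ((1 - 2 * b) * P) = \<alpha>2 * (2 * \<alpha>2 * (1 - \<kappa>1 * d3))"
      using P by (simp add: field_simps power2_eq_square)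
    then show ?thesis using assms(9) by (simp add: P_def)
  qed
  \<comment> \<open>This value is what the \<open>y\<^sup>2\<close> coefficient of the equation for
    \<open>v\<close> demands. The difference is a combination of three relations already shown;
    \<open>\<beta>1_eq\<close> enters because \<open>\<alpha>1 = 4 * (10 * d1 - \<mu> + 2 *
    \<alpha>2) - 2 * \<alpha>2 * (4 + b)\<close>.\<close>
  have Ka: "K * a = b\<^sup>2 + 7 / 2 * b"
  proof -
    have "2 * \<alpha>2 * (K * a - (b\<^sup>2 + 7 / 2 * b))
        = 2 * \<alpha>2 * \<kappa>1 * (\<alpha>3 * a - 2 * d3) + 2 * \<alpha>1 * (\<kappa>2 * \<alpha>2 * a - (1 - 2 * b) / 4)
          + 2 * ((1 - 2 * b) * (10 * d1 - \<mu> + 2 * \<alpha>2) - 2 * \<alpha>2 * (1 - \<kappa>1 * d3))"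
      unfolding K_def \<alpha>1 by (simp add: field_simps power2_eq_square)
    then show ?thesis
      using assms(9) by (simp add: \<alpha>3a \<kappa>2\<alpha>2a \<beta>1_eq)
  qed

  have "dt u t x = d1 * dxx u t x + \<beta>1 * u t x * (1 - u t x)
          - \<alpha>1 * u t x * w t x + \<alpha>2 * u t x * v t x" (is "?l = ?r") for t x
  proof -
    define y where "y = Y (x - \<mu> * t)"
    \<comment> \<open>After division by \<open>a * y\<^sup>2\<close> the residual is quadratic in
      \<open>y\<close>. Substituting \<alpha>1 cancels its linear term; \<open>\<alpha>2b\<close>
      and \<open>\<beta>1a\<close> remove the other two.\<close>
    have "?r - ?l = a * y\<^sup>2 * ((2 * \<alpha>2 * b - (24 * d1 - \<beta>1)) + y\<^sup>2 * (6 * d1 - \<beta>1 * a))"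
      unfolding u v w dt_travelling_wave(2)[OF u'] dx_travelling_wave(2)[OF u']
        dx_travelling_wave(2)[OF u''] \<alpha>1 y_def[symmetric]
      by (simp add: field_simps power2_eq_square)
    then show ?thesis by (simp add: \<beta>1a \<alpha>2b)
  qed
  moreover have "dt v t x = dxx v t x + v t x * (1 - v t x) + K * u t x * w t x
          - (\<kappa>2 * \<alpha>2 * u t x + \<kappa>1 * \<alpha>4 * w t x) * v t x" (is "?l = ?r") for t x
  proof -
    define y where "y = Y (x - \<mu> * t)"
    \<comment> \<open>The coefficient of \<open>y\<close> is
      \<open>b * (5 - 2 * \<mu> - \<kappa>1 * \<alpha>4)\<close>, so
      \<open>\<kappa>1\<alpha>4\<close> cancels it. What remains, of degrees 2 and 3, is grouped
      into multiples of \<open>Ka\<close> and \<open>\<kappa>2\<alpha>2a\<close>.\<close>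
    have "?r - ?l = y\<^sup>2 * (2 - y) / 2 * (K * a - (b\<^sup>2 + 7 / 2 * b))
        - b * y ^ 3 * (\<kappa>2 * \<alpha>2 * a - (1 - 2 * b) / 4)"
      unfolding u v w dt_travelling_wave(2)[OF v'] dx_travelling_wave(2)[OF v']
        dx_travelling_wave(2)[OF v''] \<kappa>1\<alpha>4 y_def[symmetric]
      by (simp add: field_simps power2_eq_square power3_eq_cube)
    then show ?thesis by (simp add: Ka \<kappa>2\<alpha>2a)
  qed
  moreover have "dt w t x = d3 * dxx w t x + \<beta>3 * w t x * (1 - w t x)
          - \<alpha>3 * u t x * w t x + \<alpha>4 * v t x * w t x" (is "?l = ?r") for t x
  proof -
    define y where "y = Y (x - \<mu> * t)"
    \<comment> \<open>Every term contains the factor \<open>y * (2 - y) / 2\<close>, and the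
      cofactor is affine in \<open>y\<close>. Its constant term vanishes by the choice of \<beta>3,
      its slope by \<open>\<alpha>3a\<close>.\<close>
    have "?r - ?l = - (y\<^sup>2 * (2 - y) / 2 * (\<alpha>3 * a - 2 * d3))"
      unfolding u v w dt_travelling_wave(2)[OF w'] dx_travelling_wave(2)[OF w']
        dx_travelling_wave(2)[OF w''] \<beta>3 y_def[symmetric]
      by (simp add: field_simps power2_eq_square)
    then show ?thesis by (simp add: \<alpha>3a)
  qed
  ultimately show ?thesis
    using \<open>C12 u\<close> \<open>C12 v\<close> \<open>C12 w\<close> unfolding K_def by blast
qed

end
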